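(* Let $d$ be a positive integer and let $\mathcal{C}$ be a finite family of at least $d(d+3)/2$ convex sets in $\mathbb{R}^d$. Assume that for any selection of $d(d+3)/2$ members $C_1,\dots,C_{d(d+3)/2}\in\mathcal{C}$, the intersection $\bigcap_{i=1}^{d(d+3)/2} C_i$ contains an ellipsoid of volume $1$. Then $\bigcap_{C\in\mathcal{C}} C$ also contains an ellipsoid of volume $1$.
   Context: An ellipsoid in $\mathbb{R}^d$ is an image of the closed Euclidean unit ball under a non-singular affine map. Volume is $d$-dimensional Lebesgue measure. *)

theory Defs
  imports "HOL-Analysis.Analysis"
begin

definition ellipsoid :: "(real ^ 'n) set \<Rightarrow> bool" where
  "ellipsoid E \<longleftrightarrow>
    (\<exists>(A :: real ^ 'n ^ 'n) c. invertible A \<and> E = (\<lambda>x. A *v x + c) ` cball 0 1)"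

definition contains_unit_volume_ellipsoid :: "(real ^ 'n) set \<Rightarrow> bool" where
  "contains_unit_volume_ellipsoid S \<longleftrightarrow>
    (\<exists>E. ellipsoid E \<and> measure lebesgue E = 1 \<and> E \<subseteq> S)"

end

theory Submission
  imports Defs "HOL-Library.Uprod"
begin

text \<open>
  The idea is to describe ellipsoids by points of a Euclidean space whose dimension is exactly
  \<open>N = d(d + 3)/2\<close> and to apply Helly's theorem there, with one extra convex set that takes care of
  the volume.

  Every ellipsoid can be written as \<open>L B + c\<close>, where \<open>B\<close> is the unit ball and \<open>L\<close> is lower
  triangular with positive diagonal: if the ellipsoid is \<open>A B + c\<close>, Gram-Schmidt orthonormalisation
  of the rows of \<open>A\<close> gives an orthogonal \<open>Q\<close> with \<open>A Q\<close> triangular, and \<open>Q B = B\<close>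
  (\<open>triangular_times_orthogonal\<close>). The pairs \<open>(L, c)\<close> form a space of dimension
  \<open>d(d + 1)/2 + d = N\<close>. In it, the pairs with \<open>L B + c\<close> inside the convex set \<open>C i\<close> form a convex
  set \<open>K i\<close>, and the pairs with positive diagonal and volume at least 1 form a convex set \<open>D\<close>,
  because the volume is \<open>vol B\<close> times the product of the diagonal and \<open>ln\<close> is concave
  (\<open>convex_prod_ge\<close>). Shrinking an ellipsoid towards its centre turns volume at least 1 into volume
  exactly 1, so \<open>\<Inter>i\<in>J. C i\<close> contains an ellipsoid of unit volume iff \<open>D\<close> and the \<open>K i\<close> with
  \<open>i \<in> J\<close> have a common point (\<open>contains_unit_volume_ellipsoid_iff\<close>).

  It remains to see that any \<open>N + 1\<close> of the sets \<open>D\<close> and \<open>K i\<close> meet. If \<open>D\<close> is one of them, this is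
  the hypothesis on \<open>N\<close> members of the family. Otherwise a degenerate ellipsoid suffices: by Helly's
  theorem in dimension \<open>d\<close>, where \<open>d + 1 \<le> N\<close>, there is a point \<open>c\<close> in all the \<open>C i\<close>, and \<open>(0, c)\<close>
  lies in every \<open>K i\<close>. This is why \<open>N\<close> members suffice rather than the \<open>N + 1\<close> that Helly's theorem
  for the sets \<open>K i \<inter> D\<close> would require.
\<close>

section \<open>Helly's theorem for indexed families\<close>

text \<open>
  Helly's theorem for sets of sets counts distinct members, so a family with repetitions is reduced
  to it by choosing one index for each set.
\<close>

lemma Helly_indexed:
  fixes K :: "'i \<Rightarrow> 'a::euclidean_space set"
  assumes fin: "finite I" and conv: "\<And>i. i \<in> I \<Longrightarrow> convex (K i)"
    and meet: "\<And>J. J \<subseteq> I \<Longrightarrow> card J \<le> DIM('a) + 1 \<Longrightarrow> (\<Inter>i\<in>J. K i) \<noteq> {}"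
  shows "(\<Inter>i\<in>I. K i) \<noteq> {}"
proof -
  have meet_image: "\<Inter>T \<noteq> {}" if T: "T \<subseteq> K ` I" "card T \<le> DIM('a) + 1" for T
  proof -
    obtain J where "J \<subseteq> I" "inj_on K J" "T = K ` J"
      using T(1) by (metis subset_image_inj)
    with T(2) meet[of J] show ?thesis by (simp add: card_image)
  qed
  show ?thesis
  proof (cases "card (K ` I) \<le> DIM('a) + 1")
    case True
    then show ?thesis using meet_image[of "K ` I"] by simp
  next
    case False
    show ?thesis
    proof (rule Helly)
      show "DIM('a) + 1 \<le> card (K ` I)" using False by linarith
      show "\<forall>s\<in>K ` I. convex s" using conv by blast
      show "\<Inter>T \<noteq> {}" if "T \<subseteq> K ` I" "card T = DIM('a) + 1" for T
        using meet_image that by simp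
    qed
  qed
qed

section \<open>Triangular matrices\<close>

text \<open>
  The injection \<open>r\<close> orders the indices. A permutation \<open>p\<close> with a non-zero term in the determinant
  satisfies \<open>r (p i) \<le> r i\<close> for all \<open>i\<close>; since \<open>\<Sum>i. r (p i) = \<Sum>i. r i\<close>,
  equality holds throughout and \<open>p\<close> is the identity.
\<close>

lemma det_triangular:
  fixes A :: "'a::comm_ring_1 ^ 'n ^ 'n" and r :: "'n \<Rightarrow> nat"
  assumes inj: "inj r" and zero: "\<And>i j. r i < r j \<Longrightarrow> A $ i $ j = 0"
  shows "det A = (\<Prod>i\<in>UNIV. A $ i $ i)"
proof -
  have "(\<Prod>i\<in>UNIV. A $ i $ p i) = 0" if p: "p permutes UNIV" and "p \<noteq> id" for p :: "'n \<Rightarrow> 'n"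
  proof (rule ccontr)
    assume nz: "(\<Prod>i\<in>UNIV. A $ i $ p i) \<noteq> 0"
    have le: "r (p i) \<le> r i" for i
    proof (rule ccontr)
      assume "\<not> r (p i) \<le> r i"
      then have "A $ i $ p i = 0" by (simp add: zero)
      then show False using nz by (metis UNIV_I finite prod_zero)
    qed
    have "(\<Sum>i\<in>UNIV. r (p i)) = (\<Sum>i\<in>UNIV. r i)"
      using sum.permute[OF p, of r] by (simp add: o_def)
    then have "r (p i) = r i" for i
      using le by (metis UNIV_I finite le_neq_implies_less nat_neq_iff sum_strict_mono_ex1)
    then have "p = id" using inj by (auto simp: inj_def)
    with \<open>p \<noteq> id\<close> show False by simp
  qed
  then have "det A = (\<Sum>p\<in>{id}. of_int (sign p) * (\<Prod>i\<in>UNIV. A $ i $ p i))"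
    unfolding det_def by (intro sum.mono_neutral_right) (auto simp: permutes_id)
  then show ?thesis by simp
qed

text \<open>
  Gram-Schmidt without recursion: the column \<open>q j\<close> of \<open>Q\<close> is the normalised component of row \<open>j\<close> of
  \<open>A\<close> orthogonal to all earlier rows. It lies in the span of the rows up to \<open>j\<close>, so it is orthogonal
  to every later column.
\<close>

lemma triangular_times_orthogonal:
  fixes A :: "real ^ 'n ^ 'n" and r :: "'n \<Rightarrow> nat"
  assumes inv: "invertible A" and inj: "inj r"
  obtains Q where "orthogonal_matrix Q" "\<And>i j. r i < r j \<Longrightarrow> (A ** Q) $ i $ j = 0"
    "\<And>i. (A ** Q) $ i $ i > 0"
proof -
  obtain B where AB: "A ** B = mat 1" using inv by (auto simp: invertible_def)
  let ?S = "\<lambda>j. span {A $ k |k. r k < r j}"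
  have "\<exists>q. norm q = 1 \<and> q \<in> span {A $ k |k. r k \<le> r j} \<and> (\<forall>w\<in>?S j. orthogonal q w)
    \<and> A $ j \<bullet> q > 0" for j
  proof -
    obtain y z where y: "y \<in> ?S j" and z: "\<And>w. w \<in> ?S j \<Longrightarrow> orthogonal z w"
      and yz: "A $ j = y + z"
      by (rule orthogonal_subspace_decomp_exists[of "{A $ k |k. r k < r j}" "A $ j"]) blast
    \<comment> \<open>Column \<open>j\<close> of the inverse is orthogonal to every row of \<open>A\<close> but row \<open>j\<close>, which is
      therefore not in the span of the earlier rows.\<close>
    have dual: "A $ k \<bullet> column j B = (if k = j then 1 else 0)" for k
      using arg_cong[OF AB, of "\<lambda>M. M $ k $ j"]
      by (simp add: matrix_matrix_mult_def column_def inner_vec_def mat_def)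
    have "orthogonal (column j B) y"
      using y by (rule orthogonal_to_span) (auto simp: orthogonal_def inner_commute[of "column j B"] dual)
    then have "z \<noteq> 0"
      using dual[of j] yz by (auto simp: orthogonal_def inner_commute)
    have "y \<in> span {A $ k |k. r k \<le> r j}"
      using y by (rule rev_subsetD) (intro span_mono, auto)
    moreover have "A $ j \<in> span {A $ k |k. r k \<le> r j}" by (intro span_base) auto
    ultimately have "A $ j - y \<in> span {A $ k |k. r k \<le> r j}" by (intro span_diff)
    then have "z \<in> span {A $ k |k. r k \<le> r j}" by (simp add: yz)
    moreover have "A $ j \<bullet> z = z \<bullet> z"
      using z[OF y] by (simp add: yz orthogonal_def inner_left_distrib inner_commute[of y z])
    then have "A $ j \<bullet> z > 0" using \<open>z \<noteq> 0\<close> by simp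
    ultimately show ?thesis
      using z \<open>z \<noteq> 0\<close>
      by (intro exI[of _ "z /\<^sub>R norm z"]) (auto simp: span_mul orthogonal_clauses)
  qed
  then have "\<exists>q. \<forall>j. norm (q j) = 1 \<and> q j \<in> span {A $ k |k. r k \<le> r j}
    \<and> (\<forall>w\<in>?S j. orthogonal (q j) w) \<and> A $ j \<bullet> q j > 0"
    by (intro choice allI)
  then obtain q where q: "\<And>j. norm (q j) = 1" "\<And>j. q j \<in> span {A $ k |k. r k \<le> r j}"
    "\<And>j w. w \<in> ?S j \<Longrightarrow> orthogonal (q j) w" "\<And>j. A $ j \<bullet> q j > 0"
    by blast
  have orth: "orthogonal (q i) (q j)" if "i \<noteq> j" for i j
  proof -
    have less: "orthogonal (q j) (q i)" if "r i < r j" for i j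
    proof (rule q(3))
      have "{A $ k |k. r k \<le> r i} \<subseteq> {A $ k |k. r k < r j}" using that by auto
      then show "q i \<in> ?S j" using q(2)[of i] span_mono by blast
    qed
    from that inj have "r i \<noteq> r j" by (auto simp: inj_def)
    then show ?thesis using less by (metis nat_neq_iff orthogonal_commute)
  qed
  define Q where "Q = (\<chi> i j. q j $ i)"
  have col: "column j Q = q j" for j by (simp add: Q_def column_def vec_eq_iff)
  have entry: "(A ** Q) $ i $ j = A $ i \<bullet> q j" for i j
    by (simp add: matrix_matrix_mult_def Q_def inner_vec_def)
  show ?thesis
  proof
    show "orthogonal_matrix Q"
      using q(1) orth by (simp add: orthogonal_matrix_orthonormal_columns col)
    show "(A ** Q) $ i $ j = 0" if "r i < r j" for i j
    proof -
      have "A $ i \<in> ?S j" using that by (intro span_base) auto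
      then show ?thesis using q(3)[of "A $ i" j] by (simp add: entry orthogonal_def inner_commute)
    qed
    show "(A ** Q) $ i $ i > 0" for i by (simp add: entry q(4))
  qed
qed

lemma orthogonal_matrix_image_cball:
  fixes Q :: "real ^ 'n ^ 'n"
  assumes "orthogonal_matrix Q"
  shows "(*v) Q ` cball 0 s = cball 0 s"
proof -
  have nrm: "norm (P *v x) = norm x" if "orthogonal_matrix P" for P :: "real ^ 'n ^ 'n" and x
    using that orthogonal_transformation_matrix[of "(*v) P"]
    by (simp add: orthogonal_transformation_norm)
  have Qt: "orthogonal_matrix (transpose Q)"
    using assms by (simp add: orthogonal_matrix_transpose)
  show ?thesis
  proof (intro equalityI subsetI)
    fix x :: "real ^ 'n" assume "x \<in> cball 0 s"
    then have "transpose Q *v x \<in> cball 0 s" by (simp only: mem_cball_0 nrm[OF Qt])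
    moreover have "x = Q *v (transpose Q *v x)"
      using assms by (simp only: matrix_vector_mul_assoc orthogonal_matrix_def matrix_vector_mul_lid)
    ultimately show "x \<in> (*v) Q ` cball 0 s" by blast
  qed (auto simp: nrm[OF assms])
qed

section \<open>Volumes of triangular images\<close>

lemma prod_Basis_cart:
  "(\<Prod>b\<in>(Basis :: (real ^ 'n) set). f b) = (\<Prod>i\<in>UNIV. f (axis i 1))"
proof -
  have Basis: "(Basis :: (real ^ 'n) set) = range (\<lambda>i. axis i 1)" by (auto simp: Basis_vec_def)
  have "inj (\<lambda>i::'n. axis i (1::real))" by (auto simp: inj_def axis_eq_axis)
  then show ?thesis unfolding Basis by (subst prod.reindex) (simp_all add: o_def)
qed

text \<open>
  Renaming coordinates maps boxes to boxes with the same side lengths, and Lebesgue measure is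
  determined by its values on boxes.
\<close>

lemma measure_reindex_coordinates:
  fixes h :: "'m::finite \<Rightarrow> 'n::finite" and S :: "(real ^ 'n) set"
  assumes h: "bij h" and S: "compact S"
  shows "measure lebesgue ((\<lambda>x. \<chi> i. x $ h i) ` S) = measure lebesgue S"
proof -
  let ?\<phi> = "\<lambda>x::real ^ 'n. (\<chi> i. x $ h i) :: real ^ 'm"
  let ?\<psi> = "\<lambda>y::real ^ 'm. (\<chi> j. y $ inv h j) :: real ^ 'n"
  have hinv: "h (inv h j) = j" "inv h (h i) = i" for i j
    using h by (auto simp: bij_is_surj surj_f_inv_f bij_is_inj)
  have cont: "continuous_on A ?\<phi>" for A by (intro continuous_intros)
  have meas: "?\<phi> \<in> borel_measurable borel"
    by (rule borel_measurable_continuous_onI[OF cont])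
  have "lborel = distr lborel borel ?\<phi>"
  proof (rule lborel_eqI)
    fix l u :: "real ^ 'm"
    assume "\<And>b. b \<in> Basis \<Longrightarrow> l \<bullet> b \<le> u \<bullet> b"
    then have le: "l $ i \<le> u $ i" for i
      by (metis axis_in_Basis_iff cart_eq_inner_axis Basis_real_def insertI1)
    have "?\<phi> -` box l u = box (?\<psi> l) (?\<psi> u)"
      by (auto simp: mem_box_cart) (metis hinv)+
    then have "emeasure (distr lborel borel ?\<phi>) (box l u) = emeasure lborel (box (?\<psi> l) (?\<psi> u))"
      using meas by (simp add: emeasure_distr)
    also have "\<dots> = (\<Prod>b\<in>Basis. (?\<psi> u - ?\<psi> l) \<bullet> b)"
      using le by (intro emeasure_lborel_box) (auto simp: Basis_vec_def inner_axis)
    also have "(\<Prod>b\<in>Basis. (?\<psi> u - ?\<psi> l) \<bullet> b) = (\<Prod>j\<in>UNIV. (u - l) $ inv h j)"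
      by (simp add: prod_Basis_cart inner_axis)
    also have "\<dots> = (\<Prod>i\<in>UNIV. (u - l) $ i)"
      by (rule prod.reindex_bij_betw[OF bij_betw_inv_into[OF h], of "\<lambda>i. (u - l) $ i"])
    also have "\<dots> = (\<Prod>b\<in>Basis. (u - l) \<bullet> b)"
      by (simp add: prod_Basis_cart inner_axis)
    finally show "emeasure (distr lborel borel ?\<phi>) (box l u) = (\<Prod>b\<in>Basis. (u - l) \<bullet> b)" .
  qed simp
  then have "measure lborel (?\<phi> ` S) = measure (distr lborel borel ?\<phi>) (?\<phi> ` S)" by simp
  also have "\<dots> = measure lborel (?\<phi> -` ?\<phi> ` S)"
    using meas compact_continuous_image[OF cont S]
    by (subst measure_distr) (auto intro: borel_compact)
  also have "?\<phi> -` ?\<phi> ` S = S"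
  proof (rule inj_vimage_image_eq, rule injI)
    fix x y assume eq: "?\<phi> x = ?\<phi> y"
    have "x $ j = y $ j" for j
      using arg_cong[OF eq, of "\<lambda>z. z $ inv h j"] by (simp add: hinv)
    then show "x = y" by (simp add: vec_eq_iff)
  qed
  finally show ?thesis
    using S compact_continuous_image[OF cont S] by (simp add: borel_compact)
qed

text \<open>
  The fact \<open>measure_linear_image\<close> concerns well-ordered index types. A copy of the finite index type,
  well-ordered by an arbitrarily chosen injection into the natural numbers, carries its formula over
  to every \<open>real ^ 'n\<close>.
\<close>

typedef 'n ranked = "UNIV :: 'n set"
  by simp

lemma bij_Rep_ranked: "bij Rep_ranked"
  by (metis (no_types, opaque_lifting) Abs_ranked_inverse Rep_ranked_inverse UNIV_I bij_iff)

instance ranked :: (finite) finite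
  by standard (metis bij_Rep_ranked bij_betw_finite finite)

definition rank :: "'n::finite ranked \<Rightarrow> nat" where
  "rank x = (SOME f :: 'n \<Rightarrow> nat. inj f) (Rep_ranked x)"

lemma inj_rank: "inj (rank :: 'n::finite ranked \<Rightarrow> nat)"
proof -
  have "\<exists>f :: 'n \<Rightarrow> nat. inj f"
    using finite_imp_inj_to_nat_seg[OF finite[of "UNIV :: 'n set"]] by blast
  then have "inj (SOME f :: 'n \<Rightarrow> nat. inj f)" by (rule someI_ex)
  then show ?thesis
    using inj_compose[OF _ bij_is_inj[OF bij_Rep_ranked]] by (simp add: rank_def[abs_def] o_def)
qed

instantiation ranked :: (finite) wellorder
begin

definition "x \<le> y \<longleftrightarrow> rank x \<le> rank y" for x y :: "'a ranked"

definition "x < y \<longleftrightarrow> rank x < rank y" for x y :: "'a ranked"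

instance
proof (intro_classes, unfold less_eq_ranked_def less_ranked_def)
  fix x y :: "'a ranked"
  assume "rank x \<le> rank y" "rank y \<le> rank x"
  then show "x = y" by (intro injD[OF inj_rank]) simp
next
  fix P :: "'a ranked \<Rightarrow> bool" and a
  assume "\<And>x. (\<And>y. rank y < rank x \<Longrightarrow> P y) \<Longrightarrow> P x"
  then show "P a" by (induction "rank a" arbitrary: a rule: less_induct) blast
qed linarith+

end

lemma measure_triangular_image:
  fixes A :: "real ^ 'n ^ 'n" and r :: "'n \<Rightarrow> nat"
  assumes inj: "inj r" and zero: "\<And>i j. r i < r j \<Longrightarrow> A $ i $ j = 0" and S: "compact S"
  shows "measure lebesgue ((*v) A ` S) = \<bar>\<Prod>i\<in>UNIV. A $ i $ i\<bar> * measure lebesgue S"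
proof -
  let ?\<phi> = "\<lambda>x::real ^ 'n. (\<chi> i. x $ Rep_ranked i) :: real ^ 'n ranked"
  define A' where "A' = (\<chi> i j. A $ Rep_ranked i $ Rep_ranked j)"
  have "(\<Sum>j\<in>UNIV. A $ i $ j * x $ j) = (\<Sum>j\<in>UNIV. A $ i $ Rep_ranked j * x $ Rep_ranked j)" for i x
    using sum.reindex_bij_betw[OF bij_Rep_ranked, of "\<lambda>j. A $ i $ j * x $ j"] by (rule sym)
  then have conj: "?\<phi> (A *v x) = A' *v ?\<phi> x" for x
    by (simp add: vec_eq_iff A'_def matrix_vector_mult_def)
  have "inj (r \<circ> Rep_ranked)"
    using inj bij_is_inj[OF bij_Rep_ranked] by (rule inj_compose)
  then have "det A' = (\<Prod>i\<in>UNIV. A' $ i $ i)"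
    using zero by (intro det_triangular) (auto simp: A'_def)
  also have "\<dots> = (\<Prod>i\<in>UNIV. A $ i $ i)"
    using prod.reindex_bij_betw[OF bij_Rep_ranked, of "\<lambda>i. A $ i $ i"] by (simp add: A'_def)
  finally have det: "det A' = (\<Prod>i\<in>UNIV. A $ i $ i)" .
  have \<phi>S: "compact (?\<phi> ` S)"
    using S by (intro compact_continuous_image continuous_intros)
  have "compact ((*v) A ` S)"
    using S by (intro compact_continuous_image matrix_vector_mult_linear_continuous_on)
  then have "measure lebesgue ((*v) A ` S) = measure lebesgue (?\<phi> ` (*v) A ` S)"
    using measure_reindex_coordinates[OF bij_Rep_ranked] by metis
  also have "?\<phi> ` (*v) A ` S = (*v) A' ` ?\<phi> ` S" by (simp add: image_image conj)
  also have "measure lebesgue \<dots> = \<bar>det A'\<bar> * measure lebesgue (?\<phi> ` S)"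
    using measure_linear_image[OF matrix_vector_mul_linear lmeasurable_compact[OF \<phi>S], of A']
    by (simp only: matrix_of_matrix_vector_mul)
  also have "measure lebesgue (?\<phi> ` S) = measure lebesgue S"
    by (rule measure_reindex_coordinates[OF bij_Rep_ranked S])
  finally show ?thesis by (simp only: det)
qed

section \<open>Coordinates for triangular matrices\<close>

instance uprod :: (finite) finite
  by standard simp

text \<open>
  Unordered pairs of indices, repetition allowed, label the entries on and below the diagonal, so
  that the vectors \<open>v\<close> parametrise the matrices that are lower triangular for the order of \<open>r\<close>,
  without redundancy.
\<close>

definition tri :: "('n \<Rightarrow> nat) \<Rightarrow> real ^ 'n uprod \<Rightarrow> real ^ 'n ^ 'n" where
  "tri r v = (\<chi> i j. if r j \<le> r i then v $ Upair i j else 0)"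

lemma tri_above_diagonal: "r i < r j \<Longrightarrow> tri r v $ i $ j = 0"
  by (simp add: tri_def)

lemma tri_diagonal: "tri r v $ i $ i = v $ Upair i i"
  by (simp add: tri_def)

lemma det_tri: "inj r \<Longrightarrow> det (tri r v) = (\<Prod>i\<in>UNIV. v $ Upair i i)"
  using det_triangular[of r "tri r v"] by (simp add: tri_above_diagonal tri_diagonal)

lemma tri_linear: "linear (tri r)"
  by (rule linearI) (auto simp: tri_def vec_eq_iff)

lemma tri_surj:
  fixes L :: "real ^ 'n ^ 'n" and r :: "'n \<Rightarrow> nat"
  assumes "inj r" "\<And>i j. r i < r j \<Longrightarrow> L $ i $ j = 0"
  obtains v where "tri r v = L"
proof
  \<comment> \<open>Since \<open>r\<close> is injective, an unordered pair has one ordering with \<open>r j \<le> r i\<close>.\<close>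
  let ?v = "\<chi> u. (SOME z. \<exists>i j. u = Upair i j \<and> r j \<le> r i \<and> z = L $ i $ j)"
  have "?v $ Upair i j = L $ i $ j" if "r j \<le> r i" for i j
  proof -
    have "(\<exists>i' j'. Upair i j = Upair i' j' \<and> r j' \<le> r i' \<and> z = L $ i' $ j') \<longleftrightarrow> z = L $ i $ j" for z
      using that assms(1) by (auto dest: injD)
    then show ?thesis by simp
  qed
  then show "tri r ?v = L"
    using assms(2) by (auto simp: tri_def vec_eq_iff not_le)
qed

text \<open>
  This count is the source of the Helly number \<open>d(d + 3)/2\<close>.
\<close>

lemma DIM_triangular_ellipsoids:
  "DIM((real ^ 'n uprod) \<times> (real ^ 'n)) = CARD('n) * (CARD('n) + 3) div 2"
proof -
  have "CARD('n) * (CARD('n) + 3) = CARD('n) * (CARD('n) + 1) + 2 * CARD('n)"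
    by (simp add: algebra_simps)
  then show ?thesis by (simp add: card_UNIV_uprod)
qed

section \<open>Convexity\<close>

text \<open>
  Under positivity, the inequality says \<open>(\<Sum>k\<in>S. ln (f k v)) \<ge> ln \<delta>\<close>, and the left-hand side is a
  concave function of \<open>v\<close>.
\<close>

lemma convex_prod_ge:
  fixes f :: "'k \<Rightarrow> 'a::real_vector \<Rightarrow> real"
  assumes "finite S" "\<And>k. k \<in> S \<Longrightarrow> linear (f k)" "\<delta> > 0"
  shows "convex {v. (\<forall>k\<in>S. f k v > 0) \<and> (\<Prod>k\<in>S. f k v) \<ge> \<delta>}"
proof (rule convexI; clarify)
  fix x y and s t :: real
  assume x: "\<forall>k\<in>S. f k x > 0" "(\<Prod>k\<in>S. f k x) \<ge> \<delta>"
    and y: "\<forall>k\<in>S. f k y > 0" "(\<Prod>k\<in>S. f k y) \<ge> \<delta>" and st: "0 \<le> s" "0 \<le> t" "s + t = 1"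
  let ?z = "s *\<^sub>R x + t *\<^sub>R y"
  have fz: "f k ?z = s * f k x + t * f k y" if "k \<in> S" for k
    using assms(2)[OF that] by (simp add: linear_add linear_scale)
  have pos: "f k ?z > 0" if "k \<in> S" for k
    using st x(1) y(1) that fz[OF that]
    by (smt (verit, best) mult_pos_pos mult_nonneg_nonneg)
  have ln_ge: "ln \<delta> \<le> (\<Sum>k\<in>S. ln (f k w))"
    if "\<forall>k\<in>S. f k w > 0" "(\<Prod>k\<in>S. f k w) \<ge> \<delta>" for w
    using that assms(1,3) by (subst ln_prod[symmetric]) auto
  have "ln \<delta> = s * ln \<delta> + t * ln \<delta>"
    using st by (simp flip: distrib_right)
  also have "\<dots> \<le> s * (\<Sum>k\<in>S. ln (f k x)) + t * (\<Sum>k\<in>S. ln (f k y))"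
    using st ln_ge x y by (intro add_mono mult_left_mono) auto
  also have "\<dots> = (\<Sum>k\<in>S. s * ln (f k x) + t * ln (f k y))"
    by (simp add: sum.distrib sum_distrib_left)
  also have "\<dots> \<le> (\<Sum>k\<in>S. ln (f k ?z))"
    using ln_concave st x(1) y(1) by (intro sum_mono) (auto simp: fz concave_on_iff)
  also have "\<dots> = ln (\<Prod>k\<in>S. f k ?z)"
    using assms(1) pos by (intro ln_prod[symmetric]) (simp_all add: less_imp_neq[THEN not_sym])
  finally have "\<delta> \<le> (\<Prod>k\<in>S. f k ?z)"
    using assms(3) pos by (subst (asm) ln_le_cancel_iff) (auto intro: prod_pos)
  with pos show "(\<forall>k\<in>S. f k ?z > 0) \<and> (\<Prod>k\<in>S. f k ?z) \<ge> \<delta>" by blast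
qed

lemma convex_affine_images_inside:
  fixes M :: "'a::real_vector \<Rightarrow> real ^ 'm ^ 'n"
  assumes "convex S" "linear M"
  shows "convex {(v, c). \<forall>x\<in>B. M v *v x + c \<in> S}"
proof (rule convexI)
  fix p q and s t :: real
  assume p: "p \<in> {(v, c). \<forall>x\<in>B. M v *v x + c \<in> S}"
    and q: "q \<in> {(v, c). \<forall>x\<in>B. M v *v x + c \<in> S}"
    and st: "0 \<le> s" "0 \<le> t" "s + t = 1"
  have "M (s *\<^sub>R fst p + t *\<^sub>R fst q) *v x + (s *\<^sub>R snd p + t *\<^sub>R snd q) \<in> S" if "x \<in> B" for x
  proof -
    have "s *\<^sub>R (M (fst p) *v x + snd p) + t *\<^sub>R (M (fst q) *v x + snd q) \<in> S"
      using p q st that assms(1) by (auto intro!: convexD simp: case_prod_beta)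
    also have "s *\<^sub>R (M (fst p) *v x + snd p) + t *\<^sub>R (M (fst q) *v x + snd q)
        = M (s *\<^sub>R fst p + t *\<^sub>R fst q) *v x + (s *\<^sub>R snd p + t *\<^sub>R snd q)"
      by (simp add: linear_add[OF assms(2)] linear_scale[OF assms(2)]
          matrix_vector_mult_add_rdistrib scaleR_matrix_vector_assoc scaleR_add_right add_ac)
    finally show ?thesis .
  qed
  then show "s *\<^sub>R p + t *\<^sub>R q \<in> {(v, c). \<forall>x\<in>B. M v *v x + c \<in> S}"
    by (simp add: case_prod_beta)
qed

section \<open>Ellipsoids of unit volume\<close>

lemma measure_tri_ellipsoid:
  fixes c :: "real ^ 'n"
  assumes "inj r" "\<And>i. v $ Upair i i > 0"
  shows "measure lebesgue ((\<lambda>x. tri r v *v x + c) ` cball 0 1)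
    = (\<Prod>i\<in>UNIV. v $ Upair i i) * measure lebesgue (cball 0 1 :: (real ^ 'n) set)"
proof -
  have "(\<lambda>x. tri r v *v x + c) ` cball 0 1 = (+) c ` (*v) (tri r v) ` cball 0 1"
    by (simp add: image_image add.commute)
  moreover have "(\<Prod>i\<in>UNIV. v $ Upair i i) > 0" using assms(2) by (simp add: prod_pos)
  ultimately show ?thesis
    using measure_triangular_image[of r "tri r v" "cball 0 1"] assms(1)
    by (simp add: measure_translation tri_above_diagonal tri_diagonal del: measure_completion)
qed

lemma measure_unit_cball_pos: "measure lebesgue (cball 0 1 :: (real ^ 'n) set) > 0"
  using content_cball_pos[of 1 "0 :: real ^ 'n"] by simp

text \<open>
  The right-hand side asks only for volume at least 1, which is a convex condition on \<open>v\<close>. From left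
  to right, an ellipsoid is brought to triangular form. From right to left, multiplying the matrix
  by a suitable \<open>t \<le> 1\<close> makes the volume exactly 1, and \<open>t B \<subseteq> B\<close> keeps the ellipsoid inside \<open>S\<close>.
\<close>

lemma contains_unit_volume_ellipsoid_iff:
  fixes S :: "(real ^ 'n) set" and r :: "'n \<Rightarrow> nat"
  assumes inj: "inj r" and conv: "convex S"
  shows "contains_unit_volume_ellipsoid S \<longleftrightarrow>
    (\<exists>v c. (\<forall>i. v $ Upair i i > 0)
      \<and> (\<Prod>i\<in>UNIV. v $ Upair i i) \<ge> 1 / measure lebesgue (cball 0 1 :: (real ^ 'n) set)
      \<and> (\<forall>x\<in>cball 0 1. tri r v *v x + c \<in> S))"
    (is "?lhs \<longleftrightarrow> (\<exists>v c. ?pos v \<and> ?vol v \<and> ?sub v c)")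
proof
  let ?\<beta> = "measure lebesgue (cball 0 1 :: (real ^ 'n) set)"
  have \<beta>: "?\<beta> > 0" by (rule measure_unit_cball_pos)
  {
    assume ?lhs
    then obtain A :: "real ^ 'n ^ 'n" and c where inv: "invertible A"
      and one: "measure lebesgue ((\<lambda>x. A *v x + c) ` cball 0 1) = 1"
      and sub: "(\<lambda>x. A *v x + c) ` cball 0 1 \<subseteq> S"
      by (auto simp: contains_unit_volume_ellipsoid_def ellipsoid_def)
    obtain Q where Q: "orthogonal_matrix Q"
      and AQ: "\<And>i j. r i < r j \<Longrightarrow> (A ** Q) $ i $ j = 0" "\<And>i. (A ** Q) $ i $ i > 0"
      using triangular_times_orthogonal[OF inv inj] by blast
    obtain v where v: "tri r v = A ** Q" using tri_surj[OF inj AQ(1)] .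
    have pos: "?pos v" using AQ(2) by (metis tri_diagonal v)
    have "(\<lambda>x. tri r v *v x + c) ` cball 0 1 = (\<lambda>x. A *v x + c) ` (*v) Q ` cball 0 1"
      by (simp add: v image_image flip: matrix_vector_mul_assoc)
    also have "\<dots> = (\<lambda>x. A *v x + c) ` cball 0 1"
      by (simp only: orthogonal_matrix_image_cball[OF Q])
    finally have same: "(\<lambda>x. tri r v *v x + c) ` cball 0 1 = (\<lambda>x. A *v x + c) ` cball 0 1" .
    have "(\<Prod>i\<in>UNIV. v $ Upair i i) * ?\<beta> = 1"
      using one pos measure_tri_ellipsoid[OF inj, of v c] by (simp only: same)
    then have "?vol v" using \<beta> by (simp add: divide_le_eq del: measure_completion)
    moreover have "?sub v c" using sub same by blast
    ultimately show "\<exists>v c. ?pos v \<and> ?vol v \<and> ?sub v c" using pos by blast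
  }
  assume "\<exists>v c. ?pos v \<and> ?vol v \<and> ?sub v c"
  then obtain v c where pos: "?pos v" and vol: "?vol v" and sub: "?sub v c" by blast
  let ?p = "\<Prod>i\<in>UNIV. v $ Upair i i"
  define t where "t = root CARD('n) (1 / (?p * ?\<beta>))"
  have p: "?p > 0" using pos by (simp add: prod_pos)
  have p1: "?p * ?\<beta> \<ge> 1" using vol \<beta> by (simp add: field_simps)
  have t0: "t > 0" unfolding t_def using p \<beta> by (simp add: real_root_gt_zero)
  have t1: "t \<le> 1" unfolding t_def using p1 by simp
  have tn: "t ^ CARD('n) = 1 / (?p * ?\<beta>)" unfolding t_def using p \<beta> by simp
  let ?A = "tri r (t *\<^sub>R v)"
  have det: "det ?A = t ^ CARD('n) * ?p"
    by (simp add: det_tri[OF inj] prod.distrib)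
  have "det ?A \<noteq> 0" using p t0 unfolding det by (metis less_irrefl mult_pos_pos zero_less_power)
  then have "invertible ?A" by (simp add: invertible_det_nz)
  moreover have "measure lebesgue ((\<lambda>x. ?A *v x + c) ` cball 0 1) = 1"
  proof -
    have "measure lebesgue ((\<lambda>x. ?A *v x + c) ` cball 0 1) = t ^ CARD('n) * ?p * ?\<beta>"
      using measure_tri_ellipsoid[OF inj, of "t *\<^sub>R v" c] pos t0
      by (simp add: prod.distrib del: measure_completion)
    moreover have "1 / (a * b) * a * b = 1" if "a > 0" "b > 0" for a b :: real
      using that by simp
    from this[OF p \<beta>] have "t ^ CARD('n) * ?p * ?\<beta> = 1" unfolding tn .
    ultimately show ?thesis by (rule trans)
  qed
  moreover have "?A *v x + c \<in> S" if "x \<in> cball 0 1" for x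
  proof -
    have "t *\<^sub>R x \<in> cball 0 1" using that t0 t1 by (simp add: mult_le_one)
    then have "tri r v *v (t *\<^sub>R x) + c \<in> S" using sub by blast
    then show ?thesis
      by (simp add: linear_scale[OF tri_linear] matrix_scaleR_vector_ac)
  qed
  ultimately show ?lhs
    unfolding contains_unit_volume_ellipsoid_def ellipsoid_def by blast
qed

section \<open>Helly's theorem for ellipsoids\<close>

theorem proposition1p3:
  fixes C :: "'i \<Rightarrow> (real ^ 'n) set" and I :: "'i set" and d :: nat
  assumes "d = CARD('n)"
    and "finite I"
    and "card I \<ge> d * (d + 3) div 2"
    and "\<And>i. i \<in> I \<Longrightarrow> convex (C i)"
    and "\<And>J. J \<subseteq> I \<Longrightarrow> card J = d * (d + 3) div 2 \<Longrightarrow>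
           contains_unit_volume_ellipsoid (\<Inter>i\<in>J. C i)"
  shows "contains_unit_volume_ellipsoid (\<Inter>i\<in>I. C i)"
proof -
  let ?N = "d * (d + 3) div 2" and ?\<beta> = "measure lebesgue (cball 0 1 :: (real ^ 'n) set)"
  obtain r :: "'n \<Rightarrow> nat" where r: "inj r"
    using finite_imp_inj_to_nat_seg[OF finite[of "UNIV :: 'n set"]] by blast
  have conv: "convex (\<Inter>i\<in>J. C i)" if "J \<subseteq> I" for J
    using that assms(4) by (intro convex_INT) auto
  have few: "contains_unit_volume_ellipsoid (\<Inter>i\<in>J. C i)" if J: "J \<subseteq> I" "card J \<le> ?N" for J
  proof -
    obtain J' where "J \<subseteq> J'" "J' \<subseteq> I" "card J' = ?N"
      using exists_subset_between[OF J(2) assms(3) J(1) assms(2)] by blast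
    then have "contains_unit_volume_ellipsoid (\<Inter>i\<in>J'. C i)" "(\<Inter>i\<in>J'. C i) \<subseteq> (\<Inter>i\<in>J. C i)"
      using assms(5) by auto
    then show ?thesis unfolding contains_unit_volume_ellipsoid_def by blast
  qed
  obtain k where "d = Suc k" using assms(1) by (metis not0_implies_Suc zero_less_card_finite less_irrefl)
  then have "d * (d + 3) \<ge> 2 * (d + 1)" by simp
  then have N: "d + 1 \<le> ?N" by simp
  \<comment> \<open>A common point of all the sets, to serve as the centre of a degenerate ellipsoid.\<close>
  have "(\<Inter>i\<in>I. C i) \<noteq> {}"
  proof (rule Helly_indexed[OF assms(2,4)])
    fix J assume J: "J \<subseteq> I" "card J \<le> DIM(real ^ 'n) + 1"
    then have "contains_unit_volume_ellipsoid (\<Inter>i\<in>J. C i)"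
      using N assms(1) by (intro few) auto
    then show "(\<Inter>i\<in>J. C i) \<noteq> {}"
      by (force simp: contains_unit_volume_ellipsoid_def ellipsoid_def)
  qed
  then obtain c where c: "\<And>i. i \<in> I \<Longrightarrow> c \<in> C i" by auto
  define K where "K i = {(v, c). \<forall>x\<in>cball 0 1. tri r v *v x + c \<in> C i}" for i
  define D :: "(real ^ 'n uprod) set"
    where "D = {v. (\<forall>i\<in>UNIV. v $ Upair i i > 0) \<and> (\<Prod>i\<in>UNIV. v $ Upair i i) \<ge> 1 / ?\<beta>}"
  have iff: "contains_unit_volume_ellipsoid (\<Inter>i\<in>J. C i) \<longleftrightarrow> (D \<times> UNIV) \<inter> (\<Inter>i\<in>J. K i) \<noteq> {}"
    if "J \<subseteq> I" for J
    unfolding contains_unit_volume_ellipsoid_iff[OF r conv[OF that]] K_def D_def by fastforce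
  \<comment> \<open>The family to which Helly's theorem applies: the volume condition, with index \<open>None\<close>,
    together with the containment conditions.\<close>
  define F where "F = case_option (D \<times> UNIV) K"
  have "(\<Inter>j\<in>insert None (Some ` I). F j) \<noteq> {}"
  proof (rule Helly_indexed)
    show "finite (insert None (Some ` I))" using assms(2) by simp
  next
    fix j assume j: "j \<in> insert None (Some ` I)"
    have "convex D"
      unfolding D_def using measure_unit_cball_pos
      by (intro convex_prod_ge) (auto intro: linearI)
    moreover have "convex (K i)" if "i \<in> I" for i
      unfolding K_def using convex_affine_images_inside[OF assms(4)[OF that] tri_linear] .
    ultimately show "convex (F j)" using j by (auto simp: F_def convex_Times)
  next
    fix T assume T: "T \<subseteq> insert None (Some ` I)"
      and card: "card T \<le> DIM((real ^ 'n uprod) \<times> (real ^ 'n)) + 1"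
    have finT: "finite T" using T assms(2) by (meson finite.insertI finite_imageI finite_subset)
    define J where "J = {i. Some i \<in> T}"
    have J: "J \<subseteq> I" using T by (auto simp: J_def)
    show "(\<Inter>j\<in>T. F j) \<noteq> {}"
    proof (cases "None \<in> T")
      case True
      then have TJ: "T = insert None (Some ` J)" using T by (auto simp: J_def)
      have "card T = card J + 1"
        using finite_subset[OF J assms(2)] by (simp add: TJ card_insert_if card_image)
      then have "card J \<le> ?N" using card unfolding DIM_triangular_ellipsoids assms(1) by simp
      then show ?thesis using few[OF J] iff[OF J] by (simp add: TJ F_def)
    next
      case False
      then have TJ: "T = Some ` J" using T by (auto simp: J_def)
      have "(0, c) \<in> K i" if "i \<in> J" for i
        using c J that by (auto simp: K_def linear_0[OF tri_linear])
      then show ?thesis by (auto simp: TJ F_def)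
    qed
  qed
  then show ?thesis using iff[of I] by (simp add: F_def)
qed

end
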